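(* Let $k\in\mathbb{C}$ with $k\ne0$. For every integer $m\ge0$, $$\sum_{i=0}^{m}\binom{2m-i}{i}(-k)^i\,k^{m-i}\,C_{m-i}=\delta(m,0),$$ where $C_j$ denotes the $j$-th Catalan number.
   Context: $C_j=\frac{1}{2j+1}\binom{2j+1}{j}$ for $j\ge0$, and $\delta(m,0)$ is the Kronecker delta ($1$ if $m=0$, $0$ otherwise). *)

theory Defs
  imports Complex_Main
begin

definition catalan :: "nat \<Rightarrow> 'a::field_char_0" where
  "catalan j = 1 / of_nat (2 * j + 1) * of_nat ((2 * j + 1) choose j)"

definition kronecker_delta :: "nat \<Rightarrow> nat \<Rightarrow> 'a::zero_neq_one" where
  "kronecker_delta m n = (if m = n then 1 else 0)"

end

theory Submission
  imports Defs
begin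

text \<open>
  With \<open>j = m - i\<close> the powers of \<open>k\<close> combine to the common factor \<open>(-k)^m\<close>, and what remains is
  \<open>\<Sum>j\<le>m. a j\<close> with the hypergeometric term \<open>a j = (-1)^j * (m + j choose 2j) * C j\<close>.
  Its term ratio is
  \<open>a (j + 1) / a j = - (m + j + 1) * (m - j) / ((j + 1) * (j + 2))\<close>. The sum telescopes because
  of the identity \<open>(m + j + 1) * (m - j) = m * (m + 1) - j * (j + 1)\<close>: multiplying the ratio out
  gives \<open>G (j + 1) - G j = - m * (m + 1) * a j\<close> for \<open>G j = j * (j + 1) * a j\<close>. Summation over
  \<open>j \<le> m\<close> yields \<open>m * (m + 1) * (\<Sum>j\<le>m. a j) = G 0 - G (m + 1)\<close>. Here \<open>G 0 = 0\<close> because of its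
  first factor and \<open>G (m + 1) = 0\<close> because \<open>2m + 1 choose 2m + 2\<close> vanishes, so the sum is zero
  as soon as \<open>m > 0\<close>.
\<close>

lemma catalan_0 [simp]: "catalan 0 = 1"
  by (simp add: catalan_def)

lemma catalan_fact: "catalan j = (fact (2 * j) / (fact j * fact (j + 1)) :: 'a :: field_char_0)"
proof -
  have "of_nat ((2 * j + 1) choose j)
      = (fact (2 * j + 1) / (fact j * fact (2 * j + 1 - j)) :: 'a)"
    by (rule binomial_fact) simp
  also have "2 * j + 1 - j = j + 1" by simp
  finally have choose: "of_nat ((2 * j + 1) choose j)
      = (fact (2 * j + 1) / (fact j * fact (j + 1)) :: 'a)" .
  have "(fact (2 * j + 1) :: 'a) = of_nat (2 * j + 1) * fact (2 * j)"
    by (simp only: Suc_eq_plus1 [symmetric] fact_Suc)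
  moreover have "(of_nat (2 * j + 1) :: 'a) \<noteq> 0"
    by (simp only: of_nat_eq_0_iff)
  ultimately show ?thesis
    unfolding catalan_def choose by simp
qed

lemma catalan_Suc:
  "of_nat (j + 2) * catalan (Suc j) = (of_nat (2 * (2 * j + 1)) * catalan j :: 'a :: field_char_0)"
proof -
  have nz: "(of_nat (j + 1) :: 'a) \<noteq> 0" "(of_nat (j + 2) :: 'a) \<noteq> 0"
    by (simp_all only: of_nat_eq_0_iff)
  have f1: "(fact (Suc j) :: 'a) = of_nat (j + 1) * fact j"
    and f2: "(fact (Suc (Suc j)) :: 'a) = of_nat (j + 2) * (of_nat (j + 1) * fact j)"
    and f3: "(fact (2 * Suc j) :: 'a) = of_nat (2 * (2 * j + 1)) * of_nat (j + 1) * fact (2 * j)"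
    by (simp_all add: algebra_simps)
  have "of_nat (j + 2) * catalan (Suc j)
      = (of_nat (j + 2) * (of_nat (2 * (2 * j + 1)) * of_nat (j + 1) * fact (2 * j)
         / (of_nat (j + 1) * fact j * (of_nat (j + 2) * (of_nat (j + 1) * fact j)))) :: 'a)"
    unfolding catalan_fact Suc_eq_plus1 [symmetric] f1 f2 f3 ..
  also have "\<dots> = of_nat (2 * (2 * j + 1)) * (fact (2 * j) / (fact j * (of_nat (j + 1) * fact j)))"
    using nz by (simp add: divide_simps del: of_nat_add of_nat_mult of_nat_Suc)
  also have "\<dots> = of_nat (2 * (2 * j + 1)) * catalan j"
    unfolding catalan_fact Suc_eq_plus1 [symmetric] f1 ..
  finally show ?thesis .
qed

lemma choose_double_Suc:
  assumes "j \<le> m"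
  shows "(2 * j + 2) * (2 * j + 1) * ((m + Suc j) choose (2 * Suc j))
       = (m + j + 1) * (m - j) * ((m + j) choose (2 * j))"
proof -
  have "(2 * j + 2) * ((m + Suc j) choose (2 * Suc j)) = (m + j + 1) * ((m + j) choose (2 * j + 1))"
    using Suc_times_binomial_eq [of "m + j" "2 * j + 1"] by (simp add: algebra_simps)
  moreover have "(2 * j + 1) * ((m + j) choose (2 * j + 1)) = (m - j) * ((m + j) choose (2 * j))"
    using binomial_absorb_comp [of "m + j" "2 * j"] binomial_absorption [of "2 * j" "m + j"]
    by simp
  ultimately show ?thesis
    by (metis mult.assoc mult.left_commute)
qed

definition catalan_term :: "nat \<Rightarrow> nat \<Rightarrow> 'a :: field_char_0" where
  "catalan_term m j = (- 1) ^ j * of_nat ((m + j) choose (2 * j)) * catalan j"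

lemma catalan_term_Suc:
  assumes "j \<le> m"
  shows "of_nat ((j + 1) * (j + 2)) * catalan_term m (Suc j)
       = (- of_nat ((m + j + 1) * (m - j)) * catalan_term m j :: 'a :: field_char_0)"
proof -
  define B where "B = (m + Suc j) choose (2 * Suc j)"
  have "of_nat ((j + 1) * (j + 2)) * catalan_term m (Suc j)
      = (- ((- 1) ^ j) * of_nat ((j + 1) * B) * (of_nat (j + 2) * catalan (Suc j)) :: 'a)"
    unfolding catalan_term_def B_def [symmetric] of_nat_mult power_Suc
    by (simp only: mult_ac mult_minus_left mult_minus_right mult_1_left)
  also have "\<dots> = - ((- 1) ^ j) * of_nat ((2 * j + 2) * (2 * j + 1) * B) * catalan j"
    unfolding catalan_Suc by (simp add: algebra_simps)
  also have "(2 * j + 2) * (2 * j + 1) * B = (m + j + 1) * (m - j) * ((m + j) choose (2 * j))"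
    unfolding B_def by (rule choose_double_Suc [OF assms])
  finally show ?thesis
    by (simp add: catalan_term_def mult_ac del: of_nat_add)
qed

text \<open>
  The right-hand side is \<open>- G n\<close> of the telescoping argument; the bound on \<open>n\<close> is one past the
  full range of summation, because it is at \<open>n = m + 1\<close> that \<open>G\<close> vanishes.
\<close>

lemma catalan_term_partial_sum:
  assumes "n \<le> Suc m"
  shows "of_nat (m * (m + 1)) * (\<Sum>j<n. catalan_term m j)
       = (- of_nat (n * (n + 1)) * catalan_term m n :: 'a :: field_char_0)"
  using assms
proof (induction n)
  case 0
  then show ?case by simp
next
  case (Suc n)
  then have n: "n \<le> m" by simp
  then obtain d where m: "m = n + d" by (auto simp: le_iff_add)
  have "m * (m + 1) = n * (n + 1) + (m + n + 1) * (m - n)"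
    by (simp add: m algebra_simps)
  then have split: "(of_nat (m * (m + 1)) :: 'a)
      = of_nat (n * (n + 1)) + of_nat ((m + n + 1) * (m - n))"
    by (metis of_nat_add)
  have "of_nat (m * (m + 1)) * (\<Sum>j<Suc n. catalan_term m j)
      = (- of_nat (n * (n + 1)) * catalan_term m n + of_nat (m * (m + 1)) * catalan_term m n :: 'a)"
    using Suc.IH n by (simp add: distrib_left del: of_nat_add of_nat_mult)
  also have "\<dots> = of_nat ((m + n + 1) * (m - n)) * catalan_term m n"
    unfolding split by (simp add: distrib_right del: of_nat_add of_nat_mult)
  also have "\<dots> = - (of_nat ((n + 1) * (n + 2)) * catalan_term m (Suc n))"
    unfolding catalan_term_Suc [OF n]
    by (simp only: mult_minus_left minus_minus)
  finally show ?case
    by (simp only: Suc_eq_plus1 mult_minus_left add.assoc one_add_one)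
qed

lemma sum_catalan_term:
  "(\<Sum>j\<le>m. catalan_term m j) = (kronecker_delta m 0 :: 'a :: field_char_0)"
proof (cases "m = 0")
  case True
  then show ?thesis by (simp add: catalan_term_def kronecker_delta_def)
next
  case False
  have "catalan_term m (Suc m) = (0 :: 'a)"
    by (simp add: catalan_term_def binomial_eq_0)
  then have "of_nat (m * (m + 1)) * (\<Sum>j\<le>m. catalan_term m j) = (0 :: 'a)"
    using catalan_term_partial_sum [of "Suc m" m, where ?'a = 'a]
    by (simp add: lessThan_Suc_atMost del: of_nat_add of_nat_mult)
  moreover have "(of_nat (m * (m + 1)) :: 'a) \<noteq> 0"
    using False by (simp only: of_nat_eq_0_iff) simp
  ultimately show ?thesis
    using False by (simp add: kronecker_delta_def)
qed

theorem mainTheorem15: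
  fixes k :: complex and m :: nat
  assumes "k \<noteq> 0"
  shows "(\<Sum>i=0..m. of_nat ((2 * m - i) choose i) * (- k) ^ i * k ^ (m - i) * catalan (m - i))
           = kronecker_delta m 0"
proof -
  have "(\<Sum>i=0..m. of_nat ((2 * m - i) choose i) * (- k) ^ i * k ^ (m - i) * catalan (m - i))
      = (\<Sum>j\<le>m. (- k) ^ m * catalan_term m j)"
  proof (rule sum.reindex_bij_witness [of _ "\<lambda>j. m - j" "\<lambda>i. m - i"])
    fix i assume "i \<in> {0..m}"
    then obtain j where m: "m = i + j" by (auto simp: le_iff_add)
    have "2 * m - i = m + j" and "m + j - i = 2 * j"
      by (simp_all add: m)
    then have "(2 * m - i) choose i = (m + j) choose (2 * j)"
      using binomial_symmetric [of i "m + j"] by (metis m le_add1 trans_le_add1)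
    moreover have "(- k) ^ i * k ^ j = (- k) ^ m * (- 1) ^ j"
      by (simp add: m power_add flip: power_mult_distrib)
    ultimately show "(- k) ^ m * catalan_term m (m - i)
        = of_nat ((2 * m - i) choose i) * (- k) ^ i * k ^ (m - i) * catalan (m - i)"
      by (simp add: m catalan_term_def)
  qed auto
  also have "\<dots> = (- k) ^ m * kronecker_delta m 0"
    by (simp add: sum_catalan_term flip: sum_distrib_left)
  also have "\<dots> = kronecker_delta m 0"
    by (simp add: kronecker_delta_def)
  finally show ?thesis .
qed

end
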